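(* Let $\mathcal{P}(\mathbb{N})$ be Scott's graph model and let $C:\mathcal{P}(\mathbb{N})\to\mathcal{P}(\mathbb{N})$, $C(A)=\mathbb{N}-A$, be the complement function. Then the pca $\mathcal{P}(\mathbb{N})[C]$ is decidable.
   Context: A partial combinatory algebra (pca) is a set $\mathcal{A}$ with a partial binary application $(a,b)\mapsto ab$ (associating to the left) such that there are $\mathsf{k},\mathsf{s}\in\mathcal{A}$ with, for all $a,b,c$: $\mathsf{k}ab=a$; $\mathsf{s}ab$ is defined; and whenever $(ac)(bc)$ is defined, $\mathsf{s}abc$ is defined and equals $(ac)(bc)$. A partial function $f:\mathcal{A}^n\to\mathcal{A}$ is representable in $\mathcal{A}$ if there is $a_f\in\mathcal{A}$ with $a_fa_1\cdots a_n=f(a_1,\ldots,a_n)$ for all $(a_1,\ldots,a_n)$ in the domain of $f$. Every pca contains booleans $\mathsf{T},\mathsf{F}$ with a definition-by-cases element $D$ ($D\mathsf{T}ab=a$, $D\mathsf{F}ab=b$), and standard codings $[a,b]$ of pairs and $[a_0,\ldots,a_{n-1}]$ of finite sequences whose basic operations (length, projections, appending) are representable; fix such choices. A pca $\mathcal{A}$ is decidable if the function sending each coded pair $[a,b]$ to $\mathsf{T}$ if $a=b$ and to $\mathsf{F}$ otherwise is representable in $\mathcal{A}$. For a pca $\mathcal{A}$ and a partial function $f:\mathcal{A}\to\mathcal{A}$, $\mathcal{A}[f]$ is the pca with underlying set $\mathcal{A}$ and application $\cdot_f$ defined by: $a\cdot_f b=c$ iff there is a finite sequence $e_0,\ldots,e_{n-1}$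 in $\mathcal{A}$ (on each of which $f$ is defined) such that $a[b,f(e_0),\ldots,f(e_{i-1})]=[\mathsf{F},e_i]$ for all $i<n$ and $a[b,f(e_0),\ldots,f(e_{n-1})]=[\mathsf{T},c]$. (It is known that this is a pca, that $f$ is representable in it, and that application of $\mathcal{A}$ is representable in it.) Scott's graph model is the set $\mathcal{P}(\mathbb{N})$ of subsets of $\mathbb{N}$ with application $A\circ B=\{n\mid \exists m\,([m,n]\in A,\ e_m\subseteq B)\}$, where $[\cdot,\cdot]$ is a standard bijective pairing on $\mathbb{N}$ and $e_k$ is the finite set $p$ with $k=\sum_{i\in p}2^i$. *)

theory Defs
  imports "HOL-Library.Nat_Bijection"
begin

text \<open>
  A partial application on the set of all elements of a type is a function into the option type,
  with \<^const>\<open>None\<close> for ``undefined''.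
\<close>

type_synonym 'a papp = "'a \<Rightarrow> 'a \<Rightarrow> 'a option"

text \<open>Iterated application to a list of arguments, associating to the left.\<close>

primrec apps :: "'a papp \<Rightarrow> 'a \<Rightarrow> 'a list \<Rightarrow> 'a option" where
  "apps app a [] = Some a"
| "apps app a (x # xs) = Option.bind (app a x) (\<lambda>y. apps app y xs)"

definition is_pca :: "'a papp \<Rightarrow> bool" where
  "is_pca app \<longleftrightarrow> (\<exists>k s.
     (\<forall>a b. apps app k [a, b] = Some a) \<and>
     (\<forall>a b. apps app s [a, b] \<noteq> None) \<and>
     (\<forall>a b c x y d. app a c = Some x \<longrightarrow> app b c = Some y \<longrightarrow> app x y = Some d \<longrightarrow>
        apps app s [a, b, c] = Some d))"

text \<open>
  A partial function of several arguments is given by its graph, a set of pairs of an argument list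
  and a value. Nothing is required of the representing element outside the domain.
\<close>

definition representable :: "'a papp \<Rightarrow> ('a list \<times> 'a) set \<Rightarrow> bool" where
  "representable app G \<longleftrightarrow> (\<exists>r. \<forall>(xs, y) \<in> G. apps app r xs = Some y)"

text \<open>
  A choice of booleans, pairing, numerals (the values of the length function and the indices of the
  projections) and codes of finite sequences. Every pca has such a choice; no particular one is
  singled out, only the representability of the basic operations is required. Distinctness of codes
  is not listed, since it follows from the representability of the projections and of the length.
\<close>

record 'a coding =
  tt :: 'a
  ff :: 'a
  pair :: "'a \<Rightarrow> 'a \<Rightarrow> 'a"
  num :: "nat \<Rightarrow> 'a"
  seq :: "'a list \<Rightarrow> 'a"

definition is_coding :: "'a papp \<Rightarrow> 'a coding \<Rightarrow> bool" where
  "is_coding app c \<longleftrightarrow>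
     representable app ({([tt c, a, b], a) | a b. True} \<union> {([ff c, a, b], b) | a b. True}) \<and>
     representable app {([a, b], pair c a b) | a b. True} \<and>
     representable app {([pair c a b], a) | a b. True} \<and>
     representable app {([pair c a b], b) | a b. True} \<and>
     representable app {([num c n], num c (Suc n)) | n. True} \<and>
     representable app {([num c (Suc n)], num c n) | n. True} \<and>
     representable app {([num c n], if n = 0 then tt c else ff c) | n. True} \<and>
     representable app {([seq c us], num c (length us)) | us. True} \<and>
     representable app {([num c i, seq c us], us ! i) | i us. i < length us} \<and>
     representable app {([seq c us, a], seq c (us @ [a])) | us a. True}"

definition decidable :: "'a papp \<Rightarrow> 'a coding \<Rightarrow> bool" where
  "decidable app c \<longleftrightarrow>
     representable app {([pair c a b], if a = b then tt c else ff c) | a b. True}"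

text \<open>
  The application of \<open>\<A>[f]\<close>. In the relation, \<open>es\<close> is the list of the queries and \<open>vs\<close> the list of
  the values of \<open>f\<close> on them.
\<close>

definition adjoin_rel ::
  "'a papp \<Rightarrow> 'a coding \<Rightarrow> ('a \<Rightarrow> 'a option) \<Rightarrow> 'a \<Rightarrow> 'a \<Rightarrow> 'a \<Rightarrow> bool" where
  "adjoin_rel app c f a b d \<longleftrightarrow> (\<exists>es vs.
     list_all2 (\<lambda>e v. f e = Some v) es vs \<and>
     (\<forall>i < length es. app a (seq c (b # take i vs)) = Some (pair c (ff c) (es ! i))) \<and>
     app a (seq c (b # vs)) = Some (pair c (tt c) d))"

text \<open>The description operator is justified by the lemma \<open>adjoin_eq_Some_iff\<close> below.\<close>

definition adjoin :: "'a papp \<Rightarrow> 'a coding \<Rightarrow> ('a \<Rightarrow> 'a option) \<Rightarrow> 'a papp" where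
  "adjoin app c f a b =
     (if \<exists>d. adjoin_rel app c f a b d then Some (THE d. adjoin_rel app c f a b d) else None)"

lemma is_coding_pair_inject:
  assumes "is_coding app c" and "pair c a b = pair c a' b'"
  shows "a = a' \<and> b = b'"
proof -
  have "representable app {([pair c a b], a) | a b. True}"
    using assms(1) unfolding is_coding_def by (elim conjE)
  then obtain p where p: "\<forall>(xs, y) \<in> {([pair c a b], a) | a b. True}. apps app p xs = Some y"
    unfolding representable_def by (rule exE)
  have "representable app {([pair c a b], b) | a b. True}"
    using assms(1) unfolding is_coding_def by (elim conjE)
  then obtain q where q: "\<forall>(xs, y) \<in> {([pair c a b], b) | a b. True}. apps app q xs = Some y"
    unfolding representable_def by (rule exE)
  have "apps app p [pair c a b] = Some a" "apps app p [pair c a' b'] = Some a'"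
    using p by blast+
  moreover have "apps app q [pair c a b] = Some b" "apps app q [pair c a' b'] = Some b'"
    using q by blast+
  ultimately show ?thesis using assms(2) by (simp del: apps.simps)
qed

lemma is_coding_tt_eq_ff:
  fixes a b :: 'a
  assumes "is_coding (app :: 'a papp) c" and "tt c = ff c"
  shows "a = b"
proof -
  have "representable app
      ({([tt c, a, b], a) | a b. True} \<union> {([ff c, a, b], b) | a b. True})"
    using assms(1) unfolding is_coding_def by (elim conjE)
  then obtain D where D: "\<forall>(xs, y) \<in> {([tt c, a, b], a) | a b. True} \<union>
      {([ff c, a, b], b) | a b. True}. apps app D xs = Some y"
    unfolding representable_def by (rule exE)
  have "apps app D [tt c, a, b] = Some a" "apps app D [ff c, a, b] = Some b"
    using D by blast+
  then show ?thesis using assms(2) by (simp del: apps.simps)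
qed

lemma adjoin_rel_unique:
  assumes c: "is_coding app c" and d: "adjoin_rel app c f a b d" and d': "adjoin_rel app c f a b d'"
  shows "d = d'"
proof (cases "tt c = ff c")
  case True
  then show ?thesis using is_coding_tt_eq_ff[OF c] by blast
next
  case ne: False
  obtain es vs where 1: "list_all2 (\<lambda>e v. f e = Some v) es vs"
    "\<And>i. i < length es \<Longrightarrow> app a (seq c (b # take i vs)) = Some (pair c (ff c) (es ! i))"
    "app a (seq c (b # vs)) = Some (pair c (tt c) d)"
    using d unfolding adjoin_rel_def by blast
  obtain es' vs' where 2: "list_all2 (\<lambda>e v. f e = Some v) es' vs'"
    "\<And>i. i < length es' \<Longrightarrow> app a (seq c (b # take i vs')) = Some (pair c (ff c) (es' ! i))"
    "app a (seq c (b # vs')) = Some (pair c (tt c) d')"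
    using d' unfolding adjoin_rel_def by blast
  have len: "length vs = length es" "length vs' = length es'"
    using 1(1) 2(1) by (auto dest: list_all2_lengthD)
  have eq: "i \<le> length es \<Longrightarrow> i \<le> length es' \<Longrightarrow> take i vs = take i vs'" for i
  proof (induction i)
    case (Suc i)
    then have t: "take i vs = take i vs'" by simp
    have "Some (pair c (ff c) (es ! i)) = Some (pair c (ff c) (es' ! i))"
      using 1(2)[of i] 2(2)[of i] Suc.prems t by simp
    then have "es ! i = es' ! i" using is_coding_pair_inject[OF c] by blast
    moreover have "f (es ! i) = Some (vs ! i)" "f (es' ! i) = Some (vs' ! i)"
      using 1(1) 2(1) Suc.prems by (auto simp: list_all2_conv_all_nth)
    ultimately have "vs ! i = vs' ! i" by simp
    then show ?case using t Suc.prems len by (simp add: take_Suc_conv_app_nth)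
  qed simp
  have "\<not> length es < length es'"
  proof
    assume l: "length es < length es'"
    have "pair c (tt c) d = pair c (ff c) (es' ! length es)"
      using 2(2)[OF l] 1(3) eq[of "length es"] l len by simp
    then show False using ne is_coding_pair_inject[OF c] by blast
  qed
  moreover have "\<not> length es' < length es"
  proof
    assume l: "length es' < length es"
    have "pair c (tt c) d' = pair c (ff c) (es ! length es')"
      using 1(2)[OF l] 2(3) eq[of "length es'"] l len by simp
    then show False using ne is_coding_pair_inject[OF c] by blast
  qed
  ultimately have "length es = length es'" by simp
  then have "vs = vs'" using eq[of "length es"] len by simp
  then have "pair c (tt c) d = pair c (tt c) d'" using 1(3) 2(3) by simp
  then show ?thesis using is_coding_pair_inject[OF c] by blast
qed

lemma adjoin_eq_Some_iff:
  assumes "is_coding app c"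
  shows "adjoin app c f a b = Some d \<longleftrightarrow> adjoin_rel app c f a b d"
proof -
  have the: "(THE d. adjoin_rel app c f a b d) = d" if "adjoin_rel app c f a b d" for d
    using that adjoin_rel_unique[OF assms _ that] by (rule the_equality)
  show ?thesis
  proof
    assume "adjoin app c f a b = Some d"
    then show "adjoin_rel app c f a b d"
      unfolding adjoin_def by (metis option.discI option.inject the)
  next
    assume "adjoin_rel app c f a b d"
    then show "adjoin app c f a b = Some d"
      unfolding adjoin_def using the by auto
  qed
qed

text \<open>
  Scott's graph model. The set \<open>set_decode k\<close> is the finite set \<open>p\<close> with \<open>k = (\<Sum>i\<in>p. 2 ^ i)\<close>, and
  \<open>prod_encode\<close> is the Cantor pairing.
\<close>

definition graph_app :: "nat set papp" where
  "graph_app A B = Some {n. \<exists>m. prod_encode (m, n) \<in> A \<and> set_decode m \<subseteq> B}"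

definition complement_fun :: "nat set \<Rightarrow> nat set option" where
  "complement_fun A = Some (UNIV - A)"

end

theory Submission imports Defs begin

text \<open>
  A computation of \<open>a\<close> on \<open>b\<close> in the pca with an adjoined function is a dialogue: a map from the
  list of oracle answers received so far to the next query or the final result. Dialogues
  that are Scott continuous in the answers are closed under sequential composition, and the
  continuous ones depending continuously on \<open>b\<close> are exactly those that come from some \<open>a\<close>; this gives
  \<open>\<k>\<close> and \<open>\<s>\<close>. With the complement as oracle, \<open>E = (A \<inter> -B) \<union> (B \<inter> -A)\<close> is computable from \<open>A\<close>
  and \<open>B\<close>, hence so is the continuous image \<open>W\<close> of \<open>E\<close>, which is everything if \<open>E\<close> is nonempty and
  empty otherwise. Asking for the complement of \<open>W\<close> too then turns ``\<open>E\<close> is empty'' into a positive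
  finite observation, so that both answers can be given continuously.
\<close>

section \<open>Scott continuity\<close>

text \<open>Continuity for the Scott topology: left to right says that each element of a value needs
  only finite information, and right to left yields monotonicity.\<close>

definition cont :: "(nat set \<Rightarrow> nat set) \<Rightarrow> bool" where
  "cont F \<longleftrightarrow> (\<forall>X n. n \<in> F X \<longleftrightarrow> (\<exists>Y. finite Y \<and> Y \<subseteq> X \<and> n \<in> F Y))"

named_theorems cont_intros

lemma contI:
  assumes mono: "\<And>X Y. X \<subseteq> Y \<Longrightarrow> F X \<subseteq> F Y"
    and fin: "\<And>X n. n \<in> F X \<Longrightarrow> \<exists>Y. finite Y \<and> Y \<subseteq> X \<and> n \<in> F Y"
  shows "cont F"
  unfolding cont_def
proof (intro allI iffI)
  fix X n
  assume "\<exists>Y. finite Y \<and> Y \<subseteq> X \<and> n \<in> F Y"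
  then obtain Y where "Y \<subseteq> X" "n \<in> F Y" by (elim exE conjE)
  then show "n \<in> F X" by (rule subsetD[OF mono])
qed (rule fin)

lemma cont_finite:
  assumes "cont F" "n \<in> F X"
  obtains Y where "finite Y" "Y \<subseteq> X" "n \<in> F Y"
proof -
  have "\<exists>Y. finite Y \<and> Y \<subseteq> X \<and> n \<in> F Y"
    by (rule iffD1[OF assms(1)[unfolded cont_def, THEN spec, THEN spec] assms(2)])
  then show ?thesis using that by (elim exE conjE)
qed

lemma cont_mono:
  assumes "cont F" "X \<subseteq> Y"
  shows "F X \<subseteq> F Y"
proof
  fix n
  assume "n \<in> F X"
  with assms(1) obtain Z where Z: "finite Z" "Z \<subseteq> X" "n \<in> F Z"
    by (rule cont_finite)
  then have "finite Z \<and> Z \<subseteq> Y \<and> n \<in> F Z"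
    using assms(2) by simp
  then show "n \<in> F Y"
    by (rule iffD2[OF assms(1)[unfolded cont_def, THEN spec, THEN spec] exI])
qed

lemma cont_const [cont_intros]: "cont (\<lambda>z. A)"
  by (rule contI) auto

lemma cont_id [cont_intros]: "cont (\<lambda>z. z)"
proof (rule contI)
  fix X and n :: nat
  assume "n \<in> X"
  then show "\<exists>Y. finite Y \<and> Y \<subseteq> X \<and> n \<in> Y" by (intro exI[of _ "{n}"]) simp
qed

lemma cont_UN [cont_intros]:
  assumes "\<And>i. cont (F i)"
  shows "cont (\<lambda>z. \<Union>i. F i z)"
proof (rule contI)
  show "(\<Union>i. F i X) \<subseteq> (\<Union>i. F i Y)" if "X \<subseteq> Y" for X Y
    by (intro UN_mono order_refl cont_mono[OF assms that])
next
  fix X n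
  assume "n \<in> (\<Union>i. F i X)"
  then obtain i where "n \<in> F i X" by auto
  with assms obtain Y where "finite Y" "Y \<subseteq> X" "n \<in> F i Y" by (rule cont_finite)
  then show "\<exists>Y. finite Y \<and> Y \<subseteq> X \<and> n \<in> (\<Union>i. F i Y)"
    by auto
qed

lemma cont_Un [cont_intros]:
  assumes "cont F" "cont G"
  shows "cont (\<lambda>z. F z \<union> G z)"
proof -
  have "cont (\<lambda>z. \<Union>i. (if i then F else G) z)"
    using assms by (intro cont_UN) simp
  then show ?thesis by (simp add: UNIV_bool Un_commute)
qed

text \<open>The union of finitely many finite witnesses is again finite. Application needs this
  form, since it tests inclusion of a whole finite set \<open>set_decode m\<close> in the
  argument.\<close>

lemma cont_finite_subset:
  assumes "cont F" "finite S" "S \<subseteq> F X"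
  shows "\<exists>Y. finite Y \<and> Y \<subseteq> X \<and> S \<subseteq> F Y"
proof -
  have "\<forall>n \<in> S. \<exists>Y. finite Y \<and> Y \<subseteq> X \<and> n \<in> F Y"
  proof
    fix n
    assume "n \<in> S"
    with assms(3) have "n \<in> F X" by (rule subsetD)
    with assms(1) obtain Y where "finite Y" "Y \<subseteq> X" "n \<in> F Y" by (rule cont_finite)
    then show "\<exists>Y. finite Y \<and> Y \<subseteq> X \<and> n \<in> F Y" by (intro exI conjI)
  qed
  from bchoice[OF this] obtain g
    where g: "\<forall>n \<in> S. finite (g n) \<and> g n \<subseteq> X \<and> n \<in> F (g n)" ..
  have "n \<in> F (\<Union>(g ` S))" if "n \<in> S" for n
    using cont_mono[OF assms(1), of "g n" "\<Union>(g ` S)"] bspec[OF g that] that by auto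
  then show ?thesis
    using g assms(2) by (intro exI[of _ "\<Union>(g ` S)"]) auto
qed

lemma cont_Int [cont_intros]:
  assumes "cont F" "cont G"
  shows "cont (\<lambda>z. F z \<inter> G z)"
proof (rule contI)
  show "F X \<inter> G X \<subseteq> F Y \<inter> G Y" if "X \<subseteq> Y" for X Y
    by (intro Int_mono cont_mono[OF _ that] assms)
next
  fix X n
  assume n: "n \<in> F X \<inter> G X"
  obtain Y where Y: "finite Y" "Y \<subseteq> X" "n \<in> F Y"
    using cont_finite[OF assms(1) IntD1[OF n]] .
  obtain Y' where Y': "finite Y'" "Y' \<subseteq> X" "n \<in> G Y'"
    using cont_finite[OF assms(2) IntD2[OF n]] .
  have "n \<in> F (Y \<union> Y') \<inter> G (Y \<union> Y')"
    using Y(3) Y'(3) cont_mono[OF assms(1), of Y "Y \<union> Y'"] cont_mono[OF assms(2), of Y' "Y \<union> Y'"]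
    by auto
  with Y Y' show "\<exists>Y. finite Y \<and> Y \<subseteq> X \<and> n \<in> F Y \<inter> G Y"
    by (intro exI[of _ "Y \<union> Y'"]) auto
qed

text \<open>A conditional that waits for the positive observation \<open>t\<close>; unlike a case
  distinction with two nonempty branches, it is continuous in both sets.\<close>

definition guard :: "nat \<Rightarrow> nat set \<Rightarrow> nat set \<Rightarrow> nat set" where
  "guard t A B = (if t \<in> A then B else {})"

lemma guard_simps [simp]: "t \<in> A \<Longrightarrow> guard t A B = B" "t \<notin> A \<Longrightarrow> guard t A B = {}"
  by (simp_all add: guard_def)

lemma cont_guard [cont_intros]:
  assumes "cont F" "cont G"
  shows "cont (\<lambda>z. guard t (F z) (G z))"
proof -
  have "cont (\<lambda>z. guard t (F z) UNIV)"
  proof (rule contI)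
    show "guard t (F X) UNIV \<subseteq> guard t (F Y) UNIV" if "X \<subseteq> Y" for X Y
      using cont_mono[OF assms(1) that] by (auto simp: guard_def)
  next
    fix X n
    assume "n \<in> guard t (F X) UNIV"
    then have "t \<in> F X" by (simp add: guard_def split: if_splits)
    with assms(1) obtain Y where "finite Y" "Y \<subseteq> X" "t \<in> F Y" by (rule cont_finite)
    then show "\<exists>Y. finite Y \<and> Y \<subseteq> X \<and> n \<in> guard t (F Y) UNIV"
      by (intro exI[of _ Y]) simp
  qed
  then have "cont (\<lambda>z. guard t (F z) UNIV \<inter> G z)"
    using assms(2) by (rule cont_Int)
  moreover have "guard t (F z) UNIV \<inter> G z = guard t (F z) (G z)" for z
    by (simp add: guard_def)
  ultimately show ?thesis by simp
qed

section \<open>Application in the graph model and representation of continuous functions\<close>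

definition app :: "nat set \<Rightarrow> nat set \<Rightarrow> nat set" where
  "app A B = {n. \<exists>m. prod_encode (m, n) \<in> A \<and> set_decode m \<subseteq> B}"

lemma graph_app_eq: "graph_app A B = Some (app A B)"
  by (simp add: graph_app_def app_def)

lemma app_mono: "A \<subseteq> A' \<Longrightarrow> B \<subseteq> B' \<Longrightarrow> app A B \<subseteq> app A' B'"
  unfolding app_def by blast

text \<open>Membership in a value of application rests on one element of \<open>F X\<close> and a
  finite subset of \<open>G X\<close>, hence on finite information about \<open>X\<close>.\<close>

lemma cont_app [cont_intros]:
  assumes "cont F" "cont G"
  shows "cont (\<lambda>z. app (F z) (G z))"
proof (rule contI)
  show "app (F X) (G X) \<subseteq> app (F Y) (G Y)" if "X \<subseteq> Y" for X Y
    by (rule app_mono[OF cont_mono[OF assms(1) that] cont_mono[OF assms(2) that]])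
next
  fix X n
  assume "n \<in> app (F X) (G X)"
  then obtain m where m: "prod_encode (m, n) \<in> F X" "set_decode m \<subseteq> G X"
    by (auto simp: app_def)
  obtain Y where Y: "finite Y" "Y \<subseteq> X" "prod_encode (m, n) \<in> F Y"
    using cont_finite[OF assms(1) m(1)] .
  obtain Y' where Y': "finite Y'" "Y' \<subseteq> X" "set_decode m \<subseteq> G Y'"
    using cont_finite_subset[OF assms(2) finite_set_decode m(2)] by blast
  have "n \<in> app (F (Y \<union> Y')) (G (Y \<union> Y'))"
    using Y(3) Y'(3) cont_mono[OF assms(1), of Y "Y \<union> Y'"] cont_mono[OF assms(2), of Y' "Y \<union> Y'"]
    unfolding app_def by blast
  with Y Y' show "\<exists>Y. finite Y \<and> Y \<subseteq> X \<and> n \<in> app (F Y) (G Y)"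
    by (intro exI[of _ "Y \<union> Y'"]) auto
qed

definition fun_graph :: "(nat set \<Rightarrow> nat set) \<Rightarrow> nat set" where
  "fun_graph F = {k. snd (prod_decode k) \<in> F (set_decode (fst (prod_decode k)))}"

text \<open>By continuity a finite subset of \<open>X\<close> already produces \<open>n\<close>, and
  its code paired with \<open>n\<close> lies in the graph. The other inclusion is
  monotonicity.\<close>

lemma app_fun_graph:
  assumes "cont F"
  shows "app (fun_graph F) X = F X"
proof
  show "app (fun_graph F) X \<subseteq> F X"
  proof
    fix n
    assume "n \<in> app (fun_graph F) X"
    then obtain m where "n \<in> F (set_decode m)" "set_decode m \<subseteq> X"
      by (auto simp: app_def fun_graph_def)
    then show "n \<in> F X" by (rule subsetD[OF cont_mono[OF assms], rotated])
  qed
next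
  show "F X \<subseteq> app (fun_graph F) X"
  proof
    fix n
    assume "n \<in> F X"
    with assms obtain Y where "finite Y" "Y \<subseteq> X" "n \<in> F Y" by (rule cont_finite)
    then show "n \<in> app (fun_graph F) X"
      unfolding app_def fun_graph_def by (auto intro!: exI[of _ "set_encode Y"])
  qed
qed

text \<open>A number in the graph records one membership in \<open>F z\<close> at a fixed finite
  argument, so continuity in \<open>z\<close> at each argument suffices. This makes currying
  possible.\<close>

lemma cont_fun_graph [cont_intros]:
  assumes "\<And>X. cont (\<lambda>z. F z X)"
  shows "cont (\<lambda>z. fun_graph (F z))"
proof (rule contI)
  show "fun_graph (F X) \<subseteq> fun_graph (F Y)" if "X \<subseteq> Y" for X Y
    using cont_mono[OF assms that] by (auto simp: fun_graph_def)
next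
  fix X k
  assume "k \<in> fun_graph (F X)"
  then have "snd (prod_decode k) \<in> F X (set_decode (fst (prod_decode k)))"
    by (simp add: fun_graph_def)
  with assms obtain Y where
    "finite Y" "Y \<subseteq> X" "snd (prod_decode k) \<in> F Y (set_decode (fst (prod_decode k)))"
    by (rule cont_finite)
  then show "\<exists>Y. finite Y \<and> Y \<subseteq> X \<and> k \<in> fun_graph (F Y)"
    by (intro exI[of _ Y]) (simp add: fun_graph_def)
qed

section \<open>Extraction of representing elements\<close>

lemma representable_unary:
  assumes "representable ap G"
  obtains r where "\<And>x y. ([x], y) \<in> G \<Longrightarrow> ap r x = Some y"
proof -
  obtain r where r: "\<forall>(xs, y) \<in> G. apps ap r xs = Some y"
    using assms unfolding representable_def ..
  have "ap r x = Some y" if "([x], y) \<in> G" for x y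
    using bspec[OF r that] by (simp add: bind_eq_Some_conv)
  then show ?thesis by (rule that)
qed

lemma graph_app_representable1:
  assumes "representable graph_app G"
  obtains r where "\<And>x y. ([x], y) \<in> G \<Longrightarrow> app r x = y"
proof -
  obtain r where r: "\<forall>(xs, y) \<in> G. apps graph_app r xs = Some y"
    using assms unfolding representable_def ..
  have "app r x = y" if "([x], y) \<in> G" for x y
    using bspec[OF r that] by (simp add: graph_app_eq)
  then show ?thesis by (rule that)
qed

lemma graph_app_representable2:
  assumes "representable graph_app G"
  obtains r where "\<And>x y z. ([x, y], z) \<in> G \<Longrightarrow> app (app r x) y = z"
proof -
  obtain r where r: "\<forall>(xs, y) \<in> G. apps graph_app r xs = Some y"
    using assms unfolding representable_def ..
  have "app (app r x) y = z" if "([x, y], z) \<in> G" for x y z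
    using bspec[OF r that] by (simp add: graph_app_eq)
  then show ?thesis by (rule that)
qed

lemma graph_app_representable3:
  assumes "representable graph_app G"
  obtains r where "\<And>x y z w. ([x, y, z], w) \<in> G \<Longrightarrow> app (app (app r x) y) z = w"
proof -
  obtain r where r: "\<forall>(xs, y) \<in> G. apps graph_app r xs = Some y"
    using assms unfolding representable_def ..
  have "app (app (app r x) y) z = w" if "([x, y, z], w) \<in> G" for x y z w
    using bspec[OF r that] by (simp add: graph_app_eq)
  then show ?thesis by (rule that)
qed

section \<open>Dialogues\<close>

text \<open>
  The parameters of the locale are elements representing the operations of a coding of Scott's
  graph model, together with numbers that separate its two booleans.
\<close>

locale scott_coding =
  fixes c :: "nat set coding"
    and prs p1 p2 prd zr len prj snc :: "nat set" and t1 t0 :: nat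
  assumes prs: "app (app prs a) b = pair c a b"
    and p1 [simp]: "app p1 (pair c a b) = a"
    and p2 [simp]: "app p2 (pair c a b) = b"
    and prd [simp]: "app prd (num c (Suc n)) = num c n"
    and zr [simp]: "app zr (num c n) = (if n = 0 then tt c else ff c)"
    and len [simp]: "app len (seq c us) = num c (length us)"
    and prj [simp]: "i < length us \<Longrightarrow> app (app prj (num c i)) (seq c us) = us ! i"
    and snc: "app (app snc (seq c us)) a = seq c (us @ [a])"
    and t1 [simp]: "t1 \<in> tt c" "t1 \<notin> ff c"
    and t0 [simp]: "t0 \<in> ff c" "t0 \<notin> tt c"
begin

lemma cont_pair [cont_intros]: "cont F \<Longrightarrow> cont G \<Longrightarrow> cont (\<lambda>z. pair c (F z) (G z))"
  unfolding prs[symmetric] by (intro cont_intros)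

text \<open>The coding represents appending at the end, so the induction peels off the last entry;
  the code of the empty list is constant.\<close>

lemma cont_seq: "(\<And>x. x \<in> set xs \<Longrightarrow> cont x) \<Longrightarrow> cont (\<lambda>z. seq c (map (\<lambda>x. x z) xs))"
  by (induction xs rule: rev_induct) (auto simp flip: snc intro!: cont_intros)

text \<open>Equality of sets is not continuous. A numeral is therefore compared with
  \<open>n\<close> by predecessor steps, observing \<open>t0\<close> or \<open>t1\<close> in the
  outcome of each zero test.\<close>

primrec sel :: "nat \<Rightarrow> nat set \<Rightarrow> nat set \<Rightarrow> nat set" where
  "sel 0 y B = guard t1 (app zr y) B"
| "sel (Suc n) y B = guard t0 (app zr y) (sel n (app prd y) B)"

lemma sel_num: "sel n (num c m) B = (if n = m then B else {})"
proof (induction n arbitrary: m)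
  case (Suc n)
  then show ?case by (cases m) simp_all
qed simp

lemma cont_sel [cont_intros]: "cont F \<Longrightarrow> cont G \<Longrightarrow> cont (\<lambda>z. sel n (F z) (G z))"
  by (induction n arbitrary: F) (auto intro!: cont_intros)

text \<open>Continuity of a family of dialogues, jointly in the parameter and the oracle answers.\<close>

definition dcont :: "(nat set \<Rightarrow> nat set list \<Rightarrow> nat set) \<Rightarrow> bool" where
  "dcont M \<longleftrightarrow> (\<forall>xs. (\<forall>x \<in> set xs. cont x) \<longrightarrow> cont (\<lambda>z. M z (map (\<lambda>x. x z) xs)))"

lemma dcontD: "dcont M \<Longrightarrow> (\<And>x. x \<in> set xs \<Longrightarrow> cont x) \<Longrightarrow> cont (\<lambda>z. M z (map (\<lambda>x. x z) xs))"
  by (simp add: dcont_def)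

lemma dcont_fixed: "dcont M \<Longrightarrow> cont (\<lambda>z. M z vs)"
  using dcontD[of M "map (\<lambda>v z. v) vs"] cont_const by (force simp: comp_def)

lemma dcont_Cons:
  assumes "dcont M" "cont x"
  shows "dcont (\<lambda>z vs. M z (x z # vs))"
  unfolding dcont_def
proof (intro allI impI)
  fix xs assume "\<forall>x \<in> set xs. cont x"
  then show "cont (\<lambda>z. M z (x z # map (\<lambda>x. x z) xs))"
    using dcontD[OF assms(1), of "x # xs"] assms(2) by auto
qed

definition answer :: "nat set \<Rightarrow> nat set list \<Rightarrow> nat set" where
  "answer d vs = pair c (tt c) d"

definition ask :: "nat set \<Rightarrow> nat set list \<Rightarrow> nat set" where
  "ask e vs = (case vs of [] \<Rightarrow> pair c (ff c) e | v # _ \<Rightarrow> pair c (tt c) v)"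

text \<open>The dialogue that \<open>a\<close> conducts on input \<open>b\<close> in the adjoined
  pca.\<close>

definition call :: "nat set \<Rightarrow> nat set \<Rightarrow> nat set list \<Rightarrow> nat set" where
  "call a b vs = app a (seq c (b # vs))"

text \<open>
  Observing \<open>t1\<close> in the first component of a reply of \<open>M\<close> means that \<open>M\<close> has finished, observing
  \<open>t0\<close> means that it asks another query.
\<close>

primrec andthen ::
  "(nat set list \<Rightarrow> nat set) \<Rightarrow> (nat set \<Rightarrow> nat set list \<Rightarrow> nat set) \<Rightarrow> nat set list \<Rightarrow> nat set" where
  "andthen M K [] =
     guard t1 (app p1 (M [])) (K (app p2 (M [])) []) \<union> guard t0 (app p1 (M [])) (M [])"
| "andthen M K (v # vs) =
     guard t1 (app p1 (M [])) (K (app p2 (M [])) (v # vs)) \<union>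
     guard t0 (app p1 (M [])) (andthen (\<lambda>ws. M (v # ws)) K vs)"

lemma dcont_answer [cont_intros]: "cont F \<Longrightarrow> dcont (\<lambda>z. answer (F z))"
  by (auto simp: dcont_def answer_def intro!: cont_intros)

lemma dcont_ask [cont_intros]: "cont F \<Longrightarrow> dcont (\<lambda>z. ask (F z))"
  unfolding dcont_def
proof (intro allI impI)
  fix xs assume "cont F" "\<forall>x \<in> set xs. cont x"
  then show "cont (\<lambda>z. ask (F z) (map (\<lambda>x. x z) xs))"
    by (cases xs) (auto simp: ask_def intro!: cont_intros)
qed

lemma dcont_call [cont_intros]:
  assumes "cont F" "cont G"
  shows "dcont (\<lambda>z. call (F z) (G z))"
  unfolding dcont_def call_def
proof (intro allI impI cont_app assms)
  fix xs assume "\<forall>x \<in> set xs. cont x"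
  then show "cont (\<lambda>z. seq c (G z # map (\<lambda>x. x z) xs))"
    using cont_seq[of "G # xs"] assms(2) by auto
qed

text \<open>The value handed to \<open>K\<close> is \<open>app p2 (M z [])\<close>, which itself
  varies with \<open>z\<close>; this is why \<open>K\<close> is required to be continuous along
  every continuous \<open>y\<close>.\<close>

lemma dcont_andthen [cont_intros]:
  assumes "dcont M" and K: "\<And>y. cont y \<Longrightarrow> dcont (\<lambda>z. K z (y z))"
  shows "dcont (\<lambda>z. andthen (M z) (K z))"
  unfolding dcont_def
proof (intro allI impI)
  fix xs
  assume "\<forall>x \<in> set xs. cont x"
  then show "cont (\<lambda>z. andthen (M z) (K z) (map (\<lambda>x. x z) xs))"
    using assms(1)
  proof (induction xs arbitrary: M)
    \<comment> \<open>Only the empty list of answers is fed to \<open>M z\<close> here; its reply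
      supplies both the test and the value passed on.\<close>
    case Nil
    note M = dcont_fixed[OF Nil(2), of "[]"]
    have "cont (\<lambda>z. K z (app p2 (M z [])) [])"
      by (rule dcont_fixed[OF K[OF cont_app[OF cont_const M]]])
    then show ?case
      unfolding list.map andthen.simps
      by (intro cont_Un cont_guard cont_app cont_const M)
  next
    case (Cons x xs)
    note M = dcont_fixed[OF Cons.prems(2), of "[]"]
    have "cont (\<lambda>z. K z (app p2 (M z [])) (map (\<lambda>x. x z) (x # xs)))"
      by (rule dcontD[OF K[OF cont_app[OF cont_const M]]]) (use Cons.prems(1) in auto)
    moreover have "cont (\<lambda>z. andthen (\<lambda>ws. M z (x z # ws)) (K z) (map (\<lambda>x. x z) xs))"
      using Cons.prems by (intro Cons.IH dcont_Cons) auto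
    ultimately show ?case
      unfolding list.map andthen.simps
      by (intro cont_Un cont_guard cont_app cont_const M)
  qed
qed

text \<open>
  The decoding of the list of answers has to be continuous: one takes the union over all candidate
  lengths, from which \<open>sel\<close> discards the wrong ones.
\<close>

definition lam :: "(nat set \<Rightarrow> nat set list \<Rightarrow> nat set) \<Rightarrow> nat set" where
  "lam P = fun_graph (\<lambda>x. \<Union>n. sel (Suc n) (app len x)
     (P (app (app prj (num c 0)) x) (map (\<lambda>i. app (app prj (num c (Suc i))) x) [0..<n])))"

lemma cont_lam [cont_intros]:
  assumes "\<And>b. dcont (\<lambda>z. P z b)"
  shows "cont (\<lambda>z. lam (P z))"
  unfolding lam_def by (intro cont_intros dcont_fixed[OF assms])

lemma call_lam:
  assumes P: "\<And>y. cont y \<Longrightarrow> dcont (\<lambda>z. P (y z))"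
  shows "call (lam P) b = P b"
proof
  fix vs
  have "cont (\<lambda>x. P (app (app prj (num c 0)) x)
      (map (\<lambda>i. app (app prj (num c (Suc i))) x) [0..<n]))" for n
  proof -
    have prj: "cont (app (app prj (num c i)))" for i
      by (rule cont_app[OF cont_const cont_id])
    show ?thesis
      using dcontD[OF P[OF prj], of "map (\<lambda>i. app (app prj (num c (Suc i)))) [0..<n]" 0] prj
      by (auto simp: comp_def)
  qed
  \<comment> \<open>The input \<open>b\<close> occupies position 0 of the coded list:
    \<open>n\<close> answers mean length \<open>Suc n\<close>, and answer \<open>i\<close> sits at
    position \<open>Suc i\<close>.\<close>
  then have "call (lam P) b vs = (\<Union>n. sel (Suc n) (num c (Suc (length vs)))
      (P (app (app prj (num c 0)) (seq c (b # vs)))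
        (map (\<lambda>i. app (app prj (num c (Suc i))) (seq c (b # vs))) [0..<n])))"
    unfolding call_def lam_def by (subst app_fun_graph) (auto intro!: cont_intros simp del: sel.simps)
  also have "\<dots> = P (app (app prj (num c 0)) (seq c (b # vs)))
        (map (\<lambda>i. app (app prj (num c (Suc i))) (seq c (b # vs))) [0..<length vs])"
    by (auto simp del: sel.simps simp: sel_num split: if_splits)
  also have "\<dots> = P b vs"
    by (rule arg_cong2[of _ _ _ _ P]) (auto intro!: nth_equalityI)
  finally show "call (lam P) b vs = P b vs" .
qed

section \<open>Runs of a dialogue against an oracle\<close>

text \<open>An inductive form of \<open>adjoin_rel\<close>: after an answer \<open>v\<close> the run
  goes on with the dialogue that has already received \<open>v\<close>. This permits induction on
  computations.\<close>

inductive runs :: "(nat set \<Rightarrow> nat set option) \<Rightarrow> (nat set list \<Rightarrow> nat set) \<Rightarrow> nat set \<Rightarrow> bool"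
  for f where
  finish: "M [] = pair c (tt c) d \<Longrightarrow> runs f M d"
| query: "M [] = pair c (ff c) e \<Longrightarrow> f e = Some v \<Longrightarrow> runs f (\<lambda>vs. M (v # vs)) d \<Longrightarrow> runs f M d"

lemma runs_answer: "runs f (answer d) d"
  by (rule finish) (simp add: answer_def)

lemma runs_ask: "f e = Some v \<Longrightarrow> runs f (ask e) v"
  by (rule query[where v = v]) (auto simp: ask_def intro: finish)

text \<open>Once \<open>M\<close> has finished, only the \<open>t1\<close> guard is open and the
  composite agrees with \<open>K x\<close> on all answer lists. While \<open>M\<close> asks, only
  the \<open>t0\<close> guard is open, so the query passes through unchanged.\<close>

lemma runs_andthen: "runs f M x \<Longrightarrow> runs f (K x) d \<Longrightarrow> runs f (andthen M K) d"
proof (induction M x rule: runs.induct)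
  case (finish M x)
  have "andthen M K vs = K x vs" for vs
    using finish(1) by (cases vs) simp_all
  then show ?case using finish(2) by presburger
next
  case (query M e v x)
  show ?case by (rule runs.query[where e = e and v = v]) (use query in simp_all)
qed

text \<open>Each query step of a run corresponds to the heads of the two lists.\<close>

lemma runs_iff:
  "runs f M d \<longleftrightarrow> (\<exists>es vs. list_all2 (\<lambda>e v. f e = Some v) es vs \<and>
     (\<forall>i < length es. M (take i vs) = pair c (ff c) (es ! i)) \<and> M vs = pair c (tt c) d)"
proof
  assume "runs f M d"
  then show "\<exists>es vs. list_all2 (\<lambda>e v. f e = Some v) es vs \<and>
     (\<forall>i < length es. M (take i vs) = pair c (ff c) (es ! i)) \<and> M vs = pair c (tt c) d"
  proof (induction rule: runs.induct)
    case (finish M d)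
    then show ?case by (intro exI[of _ "[]"]) simp
  next
    case (query M e v d)
    then obtain es vs where "list_all2 (\<lambda>e v. f e = Some v) es vs"
      "\<forall>i < length es. M (v # take i vs) = pair c (ff c) (es ! i)" "M (v # vs) = pair c (tt c) d"
      by blast
    with query.hyps have "list_all2 (\<lambda>e v. f e = Some v) (e # es) (v # vs) \<and>
        (\<forall>i < length (e # es). M (take i (v # vs)) = pair c (ff c) ((e # es) ! i)) \<and>
        M (v # vs) = pair c (tt c) d"
      by (auto simp: less_Suc_eq_0_disj)
    then show ?case by (intro exI)
  qed
next
  have "runs f M d" if "list_all2 (\<lambda>e v. f e = Some v) es vs"
    "\<forall>i < length es. M (take i vs) = pair c (ff c) (es ! i)" "M vs = pair c (tt c) d" for es vs
    using that
  proof (induction es vs arbitrary: M rule: list_all2_induct)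
    case (Cons e es v vs)
    have rest: "runs f (\<lambda>vs. M (v # vs)) d"
      by (rule Cons.IH) (use Cons.prems in \<open>auto simp: less_Suc_eq_0_disj\<close>)
    show ?case
      by (rule query[OF _ _ rest, where e = e]) (use Cons in \<open>auto simp: less_Suc_eq_0_disj\<close>)
  qed (auto intro: finish)
  then show "\<exists>es vs. list_all2 (\<lambda>e v. f e = Some v) es vs \<and>
     (\<forall>i < length es. M (take i vs) = pair c (ff c) (es ! i)) \<and> M vs = pair c (tt c) d \<Longrightarrow>
     runs f M d"
    by blast
qed

lemma adjoin_iff_runs:
  assumes "is_coding graph_app c"
  shows "adjoin graph_app c f a b = Some d \<longleftrightarrow> runs f (call a b) d"
  unfolding adjoin_eq_Some_iff[OF assms] adjoin_rel_def runs_iff call_def graph_app_eq by simp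

section \<open>The combinators, for an arbitrary oracle\<close>

lemma is_pca_adjoin:
  assumes "is_coding graph_app c"
  shows "is_pca (adjoin graph_app c f)"
proof -
  note iff = adjoin_iff_runs[OF assms]
  define k where "k = lam (\<lambda>a. answer (lam (\<lambda>b. answer a)))"
  \<comment> \<open>Only this innermost stage of \<open>s\<close> can consult the oracle: it runs
    \<open>a\<close> on \<open>x\<close>, then \<open>b\<close> on \<open>x\<close>, then the first
    result on the second. The outer stages answer at once.\<close>
  define S where "S a b x = andthen (call a x) (\<lambda>u. andthen (call b x) (\<lambda>v. call u v))" for a b x
  define s where "s = lam (\<lambda>a. answer (lam (\<lambda>b. answer (lam (S a b)))))"
  have k: "adjoin graph_app c f k a = Some (lam (\<lambda>b. answer a))"
    "adjoin graph_app c f (lam (\<lambda>b. answer a)) b = Some a" for a b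
    unfolding iff k_def by (subst call_lam, (intro cont_intros; assumption), rule runs_answer)+
  have s: "adjoin graph_app c f s a = Some (lam (\<lambda>b. answer (lam (S a b))))"
    "adjoin graph_app c f (lam (\<lambda>b. answer (lam (S a b)))) b = Some (lam (S a b))" for a b
    unfolding iff s_def S_def
    by (subst call_lam, (intro cont_intros; assumption), rule runs_answer)+
  have "call (lam (S a b)) x = S a b x" for a b x
    unfolding S_def by (rule call_lam) (intro cont_intros; assumption)
  then have "adjoin graph_app c f (lam (S a b)) x = Some d"
    if "adjoin graph_app c f a x = Some u" "adjoin graph_app c f b x = Some v"
      "adjoin graph_app c f u v = Some d" for a b x u v d
    using that by (auto simp: iff S_def intro: runs_andthen)
  then show ?thesis
    unfolding is_pca_def by (intro exI[of _ k] exI[of _ s]) (auto simp: k s)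
qed

section \<open>Deciding equality with the complement as oracle\<close>

lemma decidable_adjoin:
  assumes "is_coding graph_app c"
    and c': "is_coding (adjoin graph_app c complement_fun) c'"
  shows "decidable (adjoin graph_app c complement_fun) c'"
proof -
  note iff = adjoin_iff_runs[OF assms(1)]
  have "representable (adjoin graph_app c complement_fun) {([pair c' a b], a) | a b. True}"
    using c' unfolding is_coding_def by (elim conjE)
  then obtain p where p: "([x], y) \<in> {([pair c' a b], a) | a b. True} \<Longrightarrow>
      adjoin graph_app c complement_fun p x = Some y" for x y
    by (rule representable_unary) rule
  have "representable (adjoin graph_app c complement_fun) {([pair c' a b], b) | a b. True}"
    using c' unfolding is_coding_def by (elim conjE)
  then obtain q where q: "([x], y) \<in> {([pair c' a b], b) | a b. True} \<Longrightarrow>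
      adjoin graph_app c complement_fun q x = Some y" for x y
    by (rule representable_unary) rule
  \<comment> \<open>The pairs are coded by \<open>c'\<close>, a coding of the adjoined pca, so even
    the projections are dialogues that may query the oracle.\<close>
  have p: "runs complement_fun (call p (pair c' a b)) a" for a b
    unfolding iff[symmetric] by (rule p) blast
  have q: "runs complement_fun (call q (pair c' a b)) b" for a b
    unfolding iff[symmetric] by (rule q) blast
  have ask: "runs complement_fun (ask a) (- a)" for a
    by (rule runs_ask) (unfold complement_fun_def Compl_eq_Diff_UNIV, rule refl)
  \<comment> \<open>The union of guards inflates the symmetric difference to \<open>UNIV\<close> as
    soon as it has any element, whichever one it is.\<close>
  define diff where "diff a b a' b' = (\<Union>n. guard n ((a \<inter> b') \<union> (b \<inter> a')) UNIV)"
    for a b a' b' :: "nat set"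
  \<comment> \<open>The sets tested are \<open>UNIV\<close> or empty, so the number 0 is as good a
    probe as any other.\<close>
  define out where "out w w' = guard 0 w' (tt c') \<union> guard 0 w (ff c')" for w w'
  define E where "E x = andthen (call p x) (\<lambda>a. andthen (call q x) (\<lambda>b.
    andthen (ask a) (\<lambda>a'. andthen (ask b) (\<lambda>b'.
    andthen (ask (diff a b a' b')) (\<lambda>w'. answer (out (diff a b a' b') w'))))))" for x
  have "diff a b (- a) (- b) = (if a = b then {} else UNIV)" for a b
    by (auto simp: diff_def guard_def)
  then have out: "out (diff a b (- a) (- b)) (- diff a b (- a) (- b)) =
      (if a = b then tt c' else ff c')" for a b
    by (simp add: out_def)
  have "runs complement_fun (E (pair c' a b)) (if a = b then tt c' else ff c')" for a b
    \<comment> \<open>Folding the boolean back into \<open>out\<close> gives the final value the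
      form of the last \<open>answer\<close>, with \<open>- a\<close>, \<open>- b\<close> and the
      complement of \<open>diff\<close> as oracle replies.\<close>
    unfolding E_def out[symmetric]
    by (rule runs_andthen p q ask runs_answer)+
  moreover have "call (lam E) x = E x" for x
    unfolding E_def diff_def out_def by (rule call_lam) (intro cont_intros; assumption)
  ultimately have "adjoin graph_app c complement_fun (lam E) (pair c' a b) =
      Some (if a = b then tt c' else ff c')" for a b
    unfolding iff by simp
  then show ?thesis
    unfolding decidable_def representable_def by (intro exI[of _ "lam E"]) (auto split del: if_split)
qed

end

section \<open>Parameters obtained from an arbitrary coding\<close>

lemma scott_coding_exists:
  assumes "is_coding graph_app c"
  shows "\<exists>prs p1 p2 prd zr len prj snc t1 t0. scott_coding c prs p1 p2 prd zr len prj snc t1 t0"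
proof -
  have "representable graph_app
      ({([tt c, a, b], a) | a b. True} \<union> {([ff c, a, b], b) | a b. True})" (is "representable _ ?G")
    using assms unfolding is_coding_def by (elim conjE)
  then obtain D where D: "([x, y, z], w) \<in> ?G \<Longrightarrow> app (app (app D x) y) z = w" for x y z w
    by (rule graph_app_representable3) rule
  have D: "app (app (app D (tt c)) a) b = a" "app (app (app D (ff c)) a) b = b" for a b
    by (rule D; blast)+
  \<comment> \<open>Application is monotone, so if one boolean were included in the other,
    definition by cases on \<open>UNIV\<close> and \<open>{}\<close> would give \<open>UNIV\<close>
    included in \<open>{}\<close>. Hence separating numbers exist.\<close>
  have "app (app (app D x) a) b \<subseteq> app (app (app D y) a) b" if "x \<subseteq> y" for x y a b
    using that by (intro app_mono order_refl)
  from this[of "tt c" "ff c" UNIV "{}"] this[of "ff c" "tt c" "{}" UNIV]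
  have "\<not> tt c \<subseteq> ff c" "\<not> ff c \<subseteq> tt c"
    unfolding D by (auto simp: top_unique)
  then obtain t1 t0 where t: "t1 \<in> tt c" "t1 \<notin> ff c" "t0 \<in> ff c" "t0 \<notin> tt c"
    unfolding subset_iff by blast
  have "representable graph_app
      {([a, b], pair c a b) | a b. True}" (is "representable _ ?G")
    using assms unfolding is_coding_def by (elim conjE)
  then obtain prs where prs: "([x, y], z) \<in> ?G \<Longrightarrow> app (app prs x) y = z" for x y z
    by (rule graph_app_representable2) rule
  have "representable graph_app
      {([pair c a b], a) | a b. True}" (is "representable _ ?G")
    using assms unfolding is_coding_def by (elim conjE)
  then obtain p1 where p1: "([x], y) \<in> ?G \<Longrightarrow> app p1 x = y" for x y
    by (rule graph_app_representable1) rule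
  have "representable graph_app
      {([pair c a b], b) | a b. True}" (is "representable _ ?G")
    using assms unfolding is_coding_def by (elim conjE)
  then obtain p2 where p2: "([x], y) \<in> ?G \<Longrightarrow> app p2 x = y" for x y
    by (rule graph_app_representable1) rule
  have "representable graph_app
      {([num c (Suc n)], num c n) | n. True}" (is "representable _ ?G")
    using assms unfolding is_coding_def by (elim conjE)
  then obtain prd where prd: "([x], y) \<in> ?G \<Longrightarrow> app prd x = y" for x y
    by (rule graph_app_representable1) rule
  have "representable graph_app
      {([num c n], if n = 0 then tt c else ff c) | n. True}" (is "representable _ ?G")
    using assms unfolding is_coding_def by (elim conjE)
  then obtain zr where zr: "([x], y) \<in> ?G \<Longrightarrow> app zr x = y" for x y
    by (rule graph_app_representable1) rule
  have "representable graph_app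
      {([seq c us], num c (length us)) | us. True}" (is "representable _ ?G")
    using assms unfolding is_coding_def by (elim conjE)
  then obtain len where len: "([x], y) \<in> ?G \<Longrightarrow> app len x = y" for x y
    by (rule graph_app_representable1) rule
  have "representable graph_app
      {([num c i, seq c us], us ! i) | i us. i < length us}" (is "representable _ ?G")
    using assms unfolding is_coding_def by (elim conjE)
  then obtain prj where prj: "([x, y], z) \<in> ?G \<Longrightarrow> app (app prj x) y = z" for x y z
    by (rule graph_app_representable2) rule
  have "representable graph_app
      {([seq c us, a], seq c (us @ [a])) | us a. True}" (is "representable _ ?G")
    using assms unfolding is_coding_def by (elim conjE)
  then obtain snc where snc: "([x, y], z) \<in> ?G \<Longrightarrow> app (app snc x) y = z" for x y z
    by (rule graph_app_representable2) rule
  have "scott_coding c prs p1 p2 prd zr len prj snc t1 t0"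
    by (rule scott_coding.intro; (rule t | rule prs p1 p2 prd zr len prj snc, blast))
  then show ?thesis by blast
qed

theorem theorem2p4:
  fixes c :: "nat set coding"
  assumes "is_coding graph_app c"
  shows "is_pca (adjoin graph_app c complement_fun) \<and>
    (\<forall>c'. is_coding (adjoin graph_app c complement_fun) c' \<longrightarrow>
       decidable (adjoin graph_app c complement_fun) c')"
proof -
  obtain prs p1 p2 prd zr len prj snc t1 t0
    where "scott_coding c prs p1 p2 prd zr len prj snc t1 t0"
    using scott_coding_exists[OF assms] by blast
  then interpret scott_coding c prs p1 p2 prd zr len prj snc t1 t0 .
  show ?thesis using is_pca_adjoin[OF assms] decidable_adjoin[OF assms] by blast
qed

end
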